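(* Let $h(f)=f\log f-f$. For periodic or zero boundary conditions, the first-order splitting scheme (implicit relaxation step followed by forward Euler transport step) combined with the first-order numerical fluxes, as described in the context, satisfies the discrete entropy inequality $$\sum_{k=0}^K\Big\{\int\big[h(f_{1,k}^{\ell+1})+h(f_{2,k}^{\ell+1})\big]d\mathbf v\Big\}\Delta x\le\sum_{k=0}^K\Big\{\int\big[h(f_{1,k}^{\ell})+h(f_{2,k}^{\ell})\big]d\mathbf v\Big\}\Delta x,$$ provided that $$\Delta t\le\frac{\Delta x}{\max|v^1|}.$$
   Context: Species $i\in\{1,2\}$, with $j$ the other index; masses $m_i>0$. Velocities $\mathbf v=(v^1,v^2,v^3)$ range over a velocity domain $V\subset\mathbb R^3$ with $\max_V|v^1|<\infty$, and integrals are over $V$; $\Delta t,\Delta x>0$; cells $k\in\{0,\dots,K\}$; $h(0)=0$; $f_{i,k}^\ell\ge0$ with finite moments up to order two and $h(f_{i,k}^\ell)$ integrable. Let $\mathbf a_i=m_i(1,\mathbf v,|\mathbf v|^2)^\top$, $\mathbf a_{12}=m_1(1,0,\mathbf v,|\mathbf v|^2)^\top$, $\mathbf a_{21}=m_2(0,1,\mathbf v,|\mathbf v|^2)^\top$, $\Lambda=\mathbb R\times\mathbb R^3\times(-\infty,0)$, $\Lambda_{12}=\mathbb R\times\mathbb R\times\mathbb R^3\times(-\infty,0)$. Relaxation step (in each cell $k$, index suppressed): given frequencies $\nu_{ij}=\nu_{ij}^\ell(\mathbf v)\ge0$ and $c_i=\frac1{1+\Delta t(\nu_{ii}+\nu_{ij})}$,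 $$f_i^{\ell'}=c_if_i^\ell+c_i\Delta t(\nu_{ii}A_{ii}+\nu_{ij}A_{ij}),$$ where $A_{ii}=e^{\boldsymbol\lambda_i\cdot\mathbf a_i}$, $A_{12}=e^{\boldsymbol\lambda\cdot\mathbf a_{12}}$, $A_{21}=e^{\boldsymbol\lambda\cdot\mathbf a_{21}}$; $\boldsymbol\lambda_i$ is the minimizer over $\boldsymbol\alpha\in\Lambda$ of $\int c_i\nu_{ii}e^{\boldsymbol\alpha\cdot\mathbf a_i}d\mathbf v-\boldsymbol\alpha\cdot\int c_i\nu_{ii}f_i^\ell\mathbf a_i\,d\mathbf v$, and $\boldsymbol\lambda$ is the minimizer over $\boldsymbol\alpha\in\Lambda_{12}$ of $\int[c_1\nu_{12}e^{\boldsymbol\alpha\cdot\mathbf a_{12}}+c_2\nu_{21}e^{\boldsymbol\alpha\cdot\mathbf a_{21}}]d\mathbf v-\boldsymbol\alpha\cdot\int[c_1\nu_{12}f_1^\ell\mathbf a_{12}+c_2\nu_{21}f_2^\ell\mathbf a_{21}]d\mathbf v$. Standing assumption: these integrals are finite for all $\boldsymbol\alpha$ in $\Lambda$, resp. $\Lambda_{12}$, the minimizers exist and are unique, and all entropy integrals are finite. Transport step: for each $\mathbf v$, $$f_{i,k}^{\ell+1}=f_{i,k}^{\ell'}-\frac{\Delta t}{\Delta x}\big(\mathscr F_{k+\frac12}(f_i^{\ell'})-\mathscr F_{k-\frac12}(f_i^{\ell'})\big),\qquad \mathscr F_{k+\frac12}(g)=\frac{v^1}2(g_{k+1}+g_k)-\frac{|v^1|}2(g_{k+1}-g_k).$$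 The grid function is extended to ghost cells $k=-1,K+1$ with nonnegative values. Periodic boundary conditions: $f_{i,-1}^{\ell'}=f_{i,K}^{\ell'}$, $f_{i,K+1}^{\ell'}=f_{i,0}^{\ell'}$. Zero boundary conditions: the fluxes given by the formula $\mathscr F_{k+\frac12}(g)=\frac{v^1}2(g_{k+1}+g_k)-\frac{|v^1|}2(g_{k+1}-g_k)$ with $g=f_i^{\ell'}$ and $k=K$, respectively $k=-1$, satisfy $\mathscr F_{K+\frac12}(f_i^{\ell'})=\mathscr F_{-\frac12}(f_i^{\ell'})=0$ for all $\mathbf v$. *)

theory Defs
  imports "HOL-Analysis.Analysis"
begin

type_synonym velocity = "real ^ 3"

text \<open>Grid functions and collision frequencies take a cell index of type \<open>int\<close>; the physical cells are
  \<open>0, \<dots>, K\<close> and the ghost cells are \<open>-1\<close> and \<open>K + 1\<close>. Quantities carrying a species index \<open>i\<close>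
  take it first, so \<open>f i k v\<close> is the value of the distribution of species \<open>i\<close> in cell \<open>k\<close> at \<open>v\<close>,
  and \<open>\<nu> i j k v\<close> is the frequency of collisions of species \<open>i\<close> with species \<open>j\<close>.\<close>

datatype species = Sp1 | Sp2

fun other :: "species \<Rightarrow> species" where
  "other Sp1 = Sp2"
| "other Sp2 = Sp1"

text \<open>The convention \<open>h 0 = 0\<close> holds because the logarithm is multiplied by \<open>0\<close>.\<close>

definition entropy_density :: "real \<Rightarrow> real" where
  "entropy_density x = x * ln x - x"

definition finite_moments :: "velocity set \<Rightarrow> (velocity \<Rightarrow> real) \<Rightarrow> bool" where
  "finite_moments V f \<longleftrightarrow>
     set_integrable lebesgue V f \<and>
     set_integrable lebesgue V (\<lambda>v. f v *\<^sub>R v) \<and>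
     set_integrable lebesgue V (\<lambda>v. f v * (norm v)\<^sup>2)"

text \<open>The dot products with the multipliers are the inner products of the product spaces
  \<open>\<real> \<times> \<real>\<^sup>3 \<times> \<real>\<close> and \<open>\<real> \<times> \<real> \<times> \<real>\<^sup>3 \<times> \<real>\<close>.\<close>

definition invariants :: "real \<Rightarrow> velocity \<Rightarrow> real \<times> velocity \<times> real" where
  "invariants \<mu> v = \<mu> *\<^sub>R (1, v, (norm v)\<^sup>2)"

fun mix_invariants :: "(species \<Rightarrow> real) \<Rightarrow> species \<Rightarrow> velocity \<Rightarrow> real \<times> real \<times> velocity \<times> real" where
  "mix_invariants m Sp1 v = m Sp1 *\<^sub>R (1, 0, v, (norm v)\<^sup>2)"
| "mix_invariants m Sp2 v = m Sp2 *\<^sub>R (0, 1, v, (norm v)\<^sup>2)"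

definition \<Lambda>_self :: "(real \<times> velocity \<times> real) set" where
  "\<Lambda>_self = UNIV \<times> UNIV \<times> {..<0}"

definition \<Lambda>_mix :: "(real \<times> real \<times> velocity \<times> real) set" where
  "\<Lambda>_mix = UNIV \<times> UNIV \<times> UNIV \<times> {..<0}"

definition relax_coeff ::
  "real \<Rightarrow> (species \<Rightarrow> species \<Rightarrow> int \<Rightarrow> velocity \<Rightarrow> real) \<Rightarrow> species \<Rightarrow> int \<Rightarrow> velocity \<Rightarrow> real" where
  "relax_coeff dt \<nu> i k v = 1 / (1 + dt * (\<nu> i i k v + \<nu> i (other i) k v))"

definition weighted_freq ::
  "real \<Rightarrow> (species \<Rightarrow> species \<Rightarrow> int \<Rightarrow> velocity \<Rightarrow> real) \<Rightarrow>
   species \<Rightarrow> species \<Rightarrow> int \<Rightarrow> velocity \<Rightarrow> real" where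
  "weighted_freq dt \<nu> i j k v = relax_coeff dt \<nu> i k v * \<nu> i j k v"

text \<open>The weights \<open>w\<close>, \<open>w\<^sub>1\<close>, \<open>w\<^sub>2\<close> below are instantiated with \<open>c\<^sub>i \<nu>\<^sub>i\<^sub>i\<close>, \<open>c\<^sub>1 \<nu>\<^sub>1\<^sub>2\<close>, \<open>c\<^sub>2 \<nu>\<^sub>2\<^sub>1\<close>.\<close>

definition self_potential ::
  "velocity set \<Rightarrow> real \<Rightarrow> (velocity \<Rightarrow> real) \<Rightarrow> (velocity \<Rightarrow> real) \<Rightarrow> real \<times> velocity \<times> real \<Rightarrow> real" where
  "self_potential V \<mu> w f \<alpha> =
     (LINT v:V|lebesgue. w v * exp (\<alpha> \<bullet> invariants \<mu> v))
     - \<alpha> \<bullet> (LINT v:V|lebesgue. (w v * f v) *\<^sub>R invariants \<mu> v)"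

definition self_potential_finite ::
  "velocity set \<Rightarrow> real \<Rightarrow> (velocity \<Rightarrow> real) \<Rightarrow> (velocity \<Rightarrow> real) \<Rightarrow> bool" where
  "self_potential_finite V \<mu> w f \<longleftrightarrow>
     (\<forall>\<alpha>\<in>\<Lambda>_self. set_integrable lebesgue V (\<lambda>v. w v * exp (\<alpha> \<bullet> invariants \<mu> v))) \<and>
     set_integrable lebesgue V (\<lambda>v. (w v * f v) *\<^sub>R invariants \<mu> v)"

definition mix_potential ::
  "velocity set \<Rightarrow> (species \<Rightarrow> real) \<Rightarrow> (velocity \<Rightarrow> real) \<Rightarrow> (velocity \<Rightarrow> real) \<Rightarrow>
   (velocity \<Rightarrow> real) \<Rightarrow> (velocity \<Rightarrow> real) \<Rightarrow> real \<times> real \<times> velocity \<times> real \<Rightarrow> real" where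
  "mix_potential V m w\<^sub>1 w\<^sub>2 f\<^sub>1 f\<^sub>2 \<alpha> =
     (LINT v:V|lebesgue. w\<^sub>1 v * exp (\<alpha> \<bullet> mix_invariants m Sp1 v)
                       + w\<^sub>2 v * exp (\<alpha> \<bullet> mix_invariants m Sp2 v))
     - \<alpha> \<bullet> (LINT v:V|lebesgue. (w\<^sub>1 v * f\<^sub>1 v) *\<^sub>R mix_invariants m Sp1 v
                             + (w\<^sub>2 v * f\<^sub>2 v) *\<^sub>R mix_invariants m Sp2 v)"

definition mix_potential_finite ::
  "velocity set \<Rightarrow> (species \<Rightarrow> real) \<Rightarrow> (velocity \<Rightarrow> real) \<Rightarrow> (velocity \<Rightarrow> real) \<Rightarrow>
   (velocity \<Rightarrow> real) \<Rightarrow> (velocity \<Rightarrow> real) \<Rightarrow> bool" where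
  "mix_potential_finite V m w\<^sub>1 w\<^sub>2 f\<^sub>1 f\<^sub>2 \<longleftrightarrow>
     (\<forall>\<alpha>\<in>\<Lambda>_mix. set_integrable lebesgue V
        (\<lambda>v. w\<^sub>1 v * exp (\<alpha> \<bullet> mix_invariants m Sp1 v)
           + w\<^sub>2 v * exp (\<alpha> \<bullet> mix_invariants m Sp2 v))) \<and>
     set_integrable lebesgue V
        (\<lambda>v. (w\<^sub>1 v * f\<^sub>1 v) *\<^sub>R mix_invariants m Sp1 v
           + (w\<^sub>2 v * f\<^sub>2 v) *\<^sub>R mix_invariants m Sp2 v)"

definition is_unique_minimizer :: "('a \<Rightarrow> real) \<Rightarrow> 'a set \<Rightarrow> 'a \<Rightarrow> bool" where
  "is_unique_minimizer \<Phi> S x \<longleftrightarrow>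
     is_arg_min \<Phi> (\<lambda>\<alpha>. \<alpha> \<in> S) x \<and> (\<forall>y. is_arg_min \<Phi> (\<lambda>\<alpha>. \<alpha> \<in> S) y \<longrightarrow> y = x)"

definition target_self ::
  "(species \<Rightarrow> real) \<Rightarrow> (species \<Rightarrow> int \<Rightarrow> real \<times> velocity \<times> real) \<Rightarrow>
   species \<Rightarrow> int \<Rightarrow> velocity \<Rightarrow> real" where
  "target_self m lam_self i k v = exp (lam_self i k \<bullet> invariants (m i) v)"

text \<open>The targets \<open>A\<^sub>1\<^sub>2\<close> (for \<open>i = Sp1\<close>) and \<open>A\<^sub>2\<^sub>1\<close> (for \<open>i = Sp2\<close>) share the multiplier of the cell.\<close>

definition target_mix ::
  "(species \<Rightarrow> real) \<Rightarrow> (int \<Rightarrow> real \<times> real \<times> velocity \<times> real) \<Rightarrow>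
   species \<Rightarrow> int \<Rightarrow> velocity \<Rightarrow> real" where
  "target_mix m lam_mix i k v = exp (lam_mix k \<bullet> mix_invariants m i v)"

definition relaxation_step ::
  "real \<Rightarrow> (species \<Rightarrow> real) \<Rightarrow> (species \<Rightarrow> species \<Rightarrow> int \<Rightarrow> velocity \<Rightarrow> real) \<Rightarrow>
   (species \<Rightarrow> int \<Rightarrow> real \<times> velocity \<times> real) \<Rightarrow> (int \<Rightarrow> real \<times> real \<times> velocity \<times> real) \<Rightarrow>
   (species \<Rightarrow> int \<Rightarrow> velocity \<Rightarrow> real) \<Rightarrow> species \<Rightarrow> int \<Rightarrow> velocity \<Rightarrow> real" where
  "relaxation_step dt m \<nu> lam_self lam_mix f i k v =
     relax_coeff dt \<nu> i k v * f i k v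
     + relax_coeff dt \<nu> i k v * dt *
         (\<nu> i i k v * target_self m lam_self i k v + \<nu> i (other i) k v * target_mix m lam_mix i k v)"

text \<open>\<open>flux g k\<close> is the flux through the interface \<open>k + 1/2\<close>.\<close>

definition flux :: "(int \<Rightarrow> velocity \<Rightarrow> real) \<Rightarrow> int \<Rightarrow> velocity \<Rightarrow> real" where
  "flux g k v = v $ 1 / 2 * (g (k + 1) v + g k v) - \<bar>v $ 1\<bar> / 2 * (g (k + 1) v - g k v)"

definition transport_step ::
  "real \<Rightarrow> real \<Rightarrow> (int \<Rightarrow> velocity \<Rightarrow> real) \<Rightarrow> int \<Rightarrow> velocity \<Rightarrow> real" where
  "transport_step dt dx g k v = g k v - dt / dx * (flux g k v - flux g (k - 1) v)"

definition periodic_bc :: "velocity set \<Rightarrow> nat \<Rightarrow> (int \<Rightarrow> velocity \<Rightarrow> real) \<Rightarrow> bool" where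
  "periodic_bc V K g \<longleftrightarrow> (\<forall>v\<in>V. g (-1) v = g (int K) v \<and> g (int K + 1) v = g 0 v)"

definition zero_bc :: "velocity set \<Rightarrow> nat \<Rightarrow> (int \<Rightarrow> velocity \<Rightarrow> real) \<Rightarrow> bool" where
  "zero_bc V K g \<longleftrightarrow> (\<forall>v\<in>V. flux g (int K) v = 0 \<and> flux g (-1) v = 0)"

definition total_entropy ::
  "velocity set \<Rightarrow> nat \<Rightarrow> real \<Rightarrow> (species \<Rightarrow> int \<Rightarrow> velocity \<Rightarrow> real) \<Rightarrow> real" where
  "total_entropy V K dx f =
     (\<Sum>k = 0..int K.
        (LINT v:V|lebesgue. entropy_density (f Sp1 k v) + entropy_density (f Sp2 k v)) * dx)"

end

theory Submission imports Defs begin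

text \<open>
  Both steps form pointwise convex combinations, the transport step under the CFL condition, so
  Jensen's inequality for the convex function \<open>h\<close> applies to each. In the transport step the
  bounds telescope over the cells, and the boundary terms vanish for either boundary condition.

  In the relaxation step it remains to show \<open>\<integral> w (h A - h f) \<le> 0\<close> for each target
  \<open>A = exp s\<close>, \<open>s = \<lambda> \<cdot> a\<close>, with weight \<open>w\<close>, summed over the species in the mixed case.
  The tangent inequality gives \<open>h A - h f \<le> s (A - f)\<close>, and \<open>\<integral> w s (A - f) \<le> 0\<close> is
  the first-order optimality condition at \<open>\<lambda>\<close> along the ray \<open>t \<lambda>\<close>, \<open>0 < t \<le> 1\<close>, which stays
  in the cone of admissible multipliers. Only this one-sided derivative is needed; it passes under
  the integral because the difference quotients of \<open>t \<mapsto> exp (t s)\<close> at \<open>1\<close> are monotone.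
\<close>

section \<open>Convexity of the entropy density\<close>

text \<open>For \<open>x > 0\<close>, multiply \<open>1 + u \<le> exp u\<close> at
  \<open>u = ln a - ln x\<close> by \<open>x\<close>. At \<open>x = 0\<close>, where this argument
  breaks down, the convention h(0) = 0 reduces the claim to \<open>- a \<le> 0\<close>.\<close>

lemma entropy_density_tangent:
  assumes "a > 0" "x \<ge> 0"
  shows "entropy_density a + ln a * (x - a) \<le> entropy_density x"
proof (cases "x = 0")
  case True
  then show ?thesis using assms by (simp add: entropy_density_def algebra_simps)
next
  case False
  with assms have x: "x > 0" by simp
  have "x * (1 + (ln a - ln x)) \<le> x * exp (ln a - ln x)"
    using x by (intro mult_left_mono exp_ge_add_one_self) auto
  also have "\<dots> = a"
    using x assms by (simp add: exp_diff)
  finally show ?thesis by (simp add: entropy_density_def algebra_simps)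
qed

text \<open>Weight the tangent inequalities at the mean \<open>a\<close>: the linear terms cancel.
  Three points suffice for both steps: the old value and two targets in relaxation, a cell and its
  two neighbours in transport.\<close>

lemma entropy_density_Jensen3:
  assumes p: "p \<ge> 0" "q \<ge> 0" "r \<ge> 0" "p + q + r = 1"
    and x: "x \<ge> 0" "y \<ge> 0" "z \<ge> 0"
  shows "entropy_density (p * x + q * y + r * z)
    \<le> p * entropy_density x + q * entropy_density y + r * entropy_density z"
proof -
  define a where "a = p * x + q * y + r * z"
  have nonneg: "p * x \<ge> 0" "q * y \<ge> 0" "r * z \<ge> 0" using p x by simp_all
  show ?thesis
  proof (cases "a = 0")
    \<comment> \<open>There is no tangent at 0, but here every product of weight and point vanishes,
      so one factor is 0 and h(0) = 0 makes both sides 0.\<close>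
    case True
    then have "p * x = 0" "q * y = 0" "r * z = 0" using nonneg unfolding a_def by linarith+
    then have "p * entropy_density x = 0" "q * entropy_density y = 0" "r * entropy_density z = 0"
      by (auto simp: entropy_density_def)
    moreover have "entropy_density (p * x + q * y + r * z) = 0"
      using True by (simp add: a_def[symmetric]) (simp add: entropy_density_def)
    ultimately show ?thesis by linarith
  next
    case False
    then have a: "a > 0" using nonneg unfolding a_def by linarith
    have "p * (x - a) + q * (y - a) + r * (z - a) = a - (p + q + r) * a"
      by (simp add: a_def algebra_simps)
    then have "entropy_density a
        = (p + q + r) * entropy_density a + ln a * (p * (x - a) + q * (y - a) + r * (z - a))"
      using p by simp
    also have "\<dots> = p * (entropy_density a + ln a * (x - a)) + q * (entropy_density a + ln a * (y - a))
        + r * (entropy_density a + ln a * (z - a))"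
      by (simp add: algebra_simps)
    also have "\<dots> \<le> p * entropy_density x + q * entropy_density y + r * entropy_density z"
      using p x a by (intro add_mono mult_left_mono entropy_density_tangent) auto
    finally show ?thesis by (simp add: a_def)
  qed
qed

section \<open>First-order optimality along a ray\<close>

text \<open>A backward chord slope of the convex function \<tau> \<mapsto> exp (\<tau> s) at 1 is at
  most the tangent slope there. This supplies the upper half of the domination in
  \<open>integral_exp_first_order\<close>.\<close>

lemma exp_difference_quotient_le:
  fixes s t :: real
  assumes "t > 0"
  shows "(exp s - exp ((1 - t) * s)) / t \<le> s * exp s"
proof -
  have "exp s * (1 + - (t * s)) \<le> exp s * exp (- (t * s))"
    by (intro mult_left_mono exp_ge_add_one_self) auto
  also have "\<dots> = exp ((1 - t) * s)"
    by (simp add: exp_add[symmetric] algebra_simps)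
  finally show ?thesis using assms by (simp add: field_simps)
qed

text \<open>Convexity: \<open>(1 - t) * s\<close> divides the segment from \<open>s\<close> to
  \<open>(1 - u) * s\<close> with weight \<open>t / u\<close>. Shrinking the step thus raises the
  quotient, so the quotient of the largest step bounds all others from below.\<close>

lemma exp_difference_quotient_antimono:
  fixes s t u :: real
  assumes "0 < t" "t \<le> u"
  shows "(exp s - exp ((1 - u) * s)) / u \<le> (exp s - exp ((1 - t) * s)) / t"
proof -
  have "exp ((1 - t / u) * s + (t / u) * ((1 - u) * s))
      \<le> (1 - t / u) * exp s + (t / u) * exp ((1 - u) * s)"
    using assms convex_onD[OF exp_convex, of "t / u" s "(1 - u) * s"] by simp
  moreover have "(1 - t / u) * s + (t / u) * ((1 - u) * s) = (1 - t) * s"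
    using assms by (simp add: field_simps)
  ultimately have "exp ((1 - t) * s) \<le> (1 - t / u) * exp s + (t / u) * exp ((1 - u) * s)"
    by simp
  then show ?thesis using assms by (simp add: field_simps)
qed

lemma exp_difference_quotient_tendsto:
  fixes s :: real
  shows "(\<lambda>n. (exp s - exp ((1 - 1 / real (n + 2)) * s)) / (1 / real (n + 2)))
    \<longlonglongrightarrow> s * exp s"
proof -
  have "((\<lambda>t. exp ((1 - t) * s)) has_real_derivative - s * exp s) (at 0)"
    by (auto intro!: derivative_eq_intros)
  then have lim: "((\<lambda>t. (exp ((1 - t) * s) - exp s) / t) \<longlongrightarrow> - s * exp s) (at 0)"
    by (simp add: DERIV_def)
  have "(\<lambda>n. 1 / real (n + 2)) \<longlonglongrightarrow> 0"
    using LIMSEQ_ignore_initial_segment[OF lim_1_over_n, of 2] by simp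
  then have "filterlim (\<lambda>n. 1 / real (n + 2)) (at 0) sequentially"
    by (intro filterlim_atI) auto
  from tendsto_minus[OF filterlim_compose[OF lim this]] show ?thesis
    unfolding minus_divide_left minus_diff_eq by simp
qed

text \<open>On (0, 1] the function t \<mapsto> \<integral> \<Sum> w exp (t s) - t C is least at the
  right endpoint, so its left derivative there is at most 0. Here \<open>q t\<close> is the backward
  difference quotient of the integrand with step \<open>t\<close>, and \<open>g\<close> is its
  limit.\<close>

lemma integral_exp_first_order:
  fixes w s :: "'i \<Rightarrow> 'a \<Rightarrow> real"
  assumes w: "\<And>i x. i \<in> I \<Longrightarrow> x \<in> space M \<Longrightarrow> w i x \<ge> 0"
    and int: "\<And>i t. i \<in> I \<Longrightarrow> 0 < t \<Longrightarrow> t \<le> 1 \<Longrightarrow> integrable M (\<lambda>x. w i x * exp (t * s i x))"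
    and int': "\<And>i. i \<in> I \<Longrightarrow> integrable M (\<lambda>x. w i x * (s i x * exp (s i x)))"
    and min: "\<And>t. 0 < t \<Longrightarrow> t < 1 \<Longrightarrow>
      (\<integral>x. (\<Sum>i\<in>I. w i x * exp (s i x)) \<partial>M) - C \<le> (\<integral>x. (\<Sum>i\<in>I. w i x * exp (t * s i x)) \<partial>M) - t * C"
  shows "(\<integral>x. (\<Sum>i\<in>I. w i x * (s i x * exp (s i x))) \<partial>M) \<le> C"
proof -
  define q where "q t x = (\<Sum>i\<in>I. w i x * ((exp (s i x) - exp ((1 - t) * s i x)) / t))" for t x
  define g where "g x = (\<Sum>i\<in>I. w i x * (s i x * exp (s i x)))" for x
  have int1: "integrable M (\<lambda>x. w i x * exp (s i x))" if "i \<in> I" for i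
    using int[OF that, of 1] by simp
  have int_g: "integrable M g"
    unfolding g_def using int' by (intro Bochner_Integration.integrable_sum)
  have q_alt: "q t = (\<lambda>x. ((\<Sum>i\<in>I. w i x * exp (s i x)) - (\<Sum>i\<in>I. w i x * exp ((1 - t) * s i x))) / t)" for t
    by (auto simp: q_def fun_eq_iff sum_subtractf[symmetric] sum_divide_distrib right_diff_distrib)
  have sums: "integrable M (\<lambda>x. \<Sum>i\<in>I. w i x * exp (s i x))"
    "integrable M (\<lambda>x. \<Sum>i\<in>I. w i x * exp ((1 - t) * s i x))" if "0 < t" "t < 1" for t
    using int1 int that by (auto intro!: Bochner_Integration.integrable_sum)
  have int_q: "integrable M (q t)" if "0 < t" "t < 1" for t
    unfolding q_alt using sums[OF that] by auto
  have q_le_C: "(\<integral>x. q t x \<partial>M) \<le> C" if t: "0 < t" "t < 1" for t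
  proof -
    have "(\<integral>x. q t x \<partial>M)
        = ((\<integral>x. (\<Sum>i\<in>I. w i x * exp (s i x)) \<partial>M) - (\<integral>x. (\<Sum>i\<in>I. w i x * exp ((1 - t) * s i x)) \<partial>M)) / t"
      unfolding q_alt using sums[OF t] by simp
    also have "\<dots> \<le> C" using min[of "1 - t"] t by (simp add: field_simps)
    finally show ?thesis .
  qed
  have t01: "0 < 1 / real (n + 2)" "1 / real (n + 2) < 1" for n by auto
  have "(\<lambda>n. \<integral>x. q (1 / real (n + 2)) x \<partial>M) \<longlonglongrightarrow> (\<integral>x. g x \<partial>M)"
  proof (rule integral_dominated_convergence)
    \<comment> \<open>The steps \<open>1 / real (n + 2)\<close> keep \<open>1 - t\<close> inside (0,
      1), and the largest is 1/2. Hence every quotient lies between \<open>q (1/2)\<close> and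
      \<open>g\<close>, both integrable.\<close>
    show "integrable M (\<lambda>x. \<bar>q (1/2) x\<bar> + \<bar>g x\<bar>)"
      using int_q int_g by (intro Bochner_Integration.integrable_add integrable_abs) auto
    show "AE x in M. (\<lambda>n. q (1 / real (n + 2)) x) \<longlonglongrightarrow> g x"
      unfolding q_def g_def
      by (intro AE_I2 tendsto_sum tendsto_mult tendsto_const exp_difference_quotient_tendsto)
    show "AE x in M. norm (q (1 / real (n + 2)) x) \<le> \<bar>q (1/2) x\<bar> + \<bar>g x\<bar>" for n
    proof (rule AE_I2)
      fix x assume x: "x \<in> space M"
      have "q (1 / real (n + 2)) x \<le> g x" unfolding q_def g_def
        using x w by (intro sum_mono mult_left_mono exp_difference_quotient_le) auto
      moreover have "q (1/2) x \<le> q (1 / real (n + 2)) x" unfolding q_def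
        using x w by (intro sum_mono mult_left_mono exp_difference_quotient_antimono)
          (auto simp: field_simps)
      ultimately show "norm (q (1 / real (n + 2)) x) \<le> \<bar>q (1/2) x\<bar> + \<bar>g x\<bar>" by simp
    qed
  qed (use int_q[OF t01] int_g in auto)
  then have "(\<integral>x. g x \<partial>M) \<le> C"
    by (rule LIMSEQ_le_const2) (use q_le_C[OF t01] in auto)
  then show ?thesis by (simp add: g_def)
qed

text \<open>The common core of both collision types: \<open>I\<close> is a singleton for
  self-collisions and the two species for mixed ones. Only the exponents \<open>s i\<close> along
  the ray enter, so the form of the invariants is irrelevant here.\<close>

lemma minimizer_entropy_le:
  fixes w s f :: "'i \<Rightarrow> 'a \<Rightarrow> real"
  assumes w: "\<And>i x. i \<in> I \<Longrightarrow> x \<in> space M \<Longrightarrow> w i x \<ge> 0"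
    and f: "\<And>i x. i \<in> I \<Longrightarrow> x \<in> space M \<Longrightarrow> f i x \<ge> 0"
    and int: "\<And>i t. i \<in> I \<Longrightarrow> 0 < t \<Longrightarrow> t \<le> 1 \<Longrightarrow> integrable M (\<lambda>x. w i x * exp (t * s i x))"
    and int_A: "\<And>i. i \<in> I \<Longrightarrow> integrable M (\<lambda>x. w i x * entropy_density (exp (s i x)))"
    and int_f: "\<And>i. i \<in> I \<Longrightarrow> integrable M (\<lambda>x. w i x * entropy_density (f i x))"
    and int_fs: "\<And>i. i \<in> I \<Longrightarrow> integrable M (\<lambda>x. w i x * f i x * s i x)"
    and min: "\<And>t. 0 < t \<Longrightarrow> t < 1 \<Longrightarrow>
      (\<integral>x. (\<Sum>i\<in>I. w i x * exp (s i x)) \<partial>M) - (\<integral>x. (\<Sum>i\<in>I. w i x * f i x * s i x) \<partial>M)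
      \<le> (\<integral>x. (\<Sum>i\<in>I. w i x * exp (t * s i x)) \<partial>M) - t * (\<integral>x. (\<Sum>i\<in>I. w i x * f i x * s i x) \<partial>M)"
  shows "(\<integral>x. (\<Sum>i\<in>I. w i x * (entropy_density (exp (s i x)) - entropy_density (f i x))) \<partial>M) \<le> 0"
proof -
  have int': "integrable M (\<lambda>x. w i x * (s i x * exp (s i x)))" if "i \<in> I" for i
  proof -
    \<comment> \<open>Since h(exp s) = s exp s - exp s, integrability of the weighted derivative
      follows from that of the target's entropy and mass.\<close>
    have "w i x * (s i x * exp (s i x))
        = w i x * entropy_density (exp (s i x)) + w i x * exp (1 * s i x)" for x
      by (simp add: entropy_density_def algebra_simps)
    then show ?thesis using int_A[OF that] int[OF that, of 1] by simp
  qed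
  have sums: "integrable M (\<lambda>x. \<Sum>i\<in>I. w i x * (s i x * exp (s i x)))"
    "integrable M (\<lambda>x. \<Sum>i\<in>I. w i x * f i x * s i x)"
    using int' int_fs by (auto intro!: Bochner_Integration.integrable_sum)
  have "(\<integral>x. (\<Sum>i\<in>I. w i x * (entropy_density (exp (s i x)) - entropy_density (f i x))) \<partial>M)
    \<le> (\<integral>x. (\<Sum>i\<in>I. w i x * (s i x * exp (s i x))) - (\<Sum>i\<in>I. w i x * f i x * s i x) \<partial>M)"
  proof (rule integral_mono)
    show "integrable M (\<lambda>x. \<Sum>i\<in>I. w i x * (entropy_density (exp (s i x)) - entropy_density (f i x)))"
      using int_A int_f
      by (intro Bochner_Integration.integrable_sum) (simp add: right_diff_distrib)
    fix x assume x: "x \<in> space M"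
    have "w i x * (entropy_density (exp (s i x)) - entropy_density (f i x))
        \<le> w i x * (s i x * exp (s i x)) - w i x * f i x * s i x" if i: "i \<in> I" for i
    proof -
      \<comment> \<open>The tangent is taken at the target \<open>exp (s i x)\<close>, where the
        slope of h is \<open>s i x\<close>.\<close>
      have "entropy_density (exp (s i x)) - entropy_density (f i x) \<le> s i x * exp (s i x) - f i x * s i x"
        using entropy_density_tangent[of "exp (s i x)" "f i x"] f[OF i x] by (simp add: algebra_simps)
      from mult_left_mono[OF this w[OF i x]] show ?thesis by (simp add: algebra_simps)
    qed
    then show "(\<Sum>i\<in>I. w i x * (entropy_density (exp (s i x)) - entropy_density (f i x)))
      \<le> (\<Sum>i\<in>I. w i x * (s i x * exp (s i x))) - (\<Sum>i\<in>I. w i x * f i x * s i x)"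
      by (simp add: sum_subtractf[symmetric] sum_mono)
  qed (use sums in simp)
  also have "\<dots> \<le> 0"
    using integral_exp_first_order[OF w int int' min] sums by simp
  finally show ?thesis .
qed

section \<open>Minimizers, invariants and integrability\<close>

lemma is_unique_minimizer_le:
  "is_unique_minimizer \<Phi> S x \<Longrightarrow> y \<in> S \<Longrightarrow> \<Phi> x \<le> \<Phi> y"
  by (force simp: is_unique_minimizer_def is_arg_min_linorder)

text \<open>Exhibits the exponent as a quadratic polynomial in \<open>v\<close>, the form to which
  moments up to order two apply.\<close>

lemma inner_invariants:
  "\<alpha> \<bullet> invariants \<mu> v
    = \<mu> * fst \<alpha> + (\<mu> *\<^sub>R fst (snd \<alpha>)) \<bullet> v + \<mu> * snd (snd \<alpha>) * (norm v)\<^sup>2"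
  by (cases \<alpha>) (simp add: invariants_def algebra_simps)

lemma inner_mix_invariants:
  "\<alpha> \<bullet> mix_invariants m i v = m i * (case i of Sp1 \<Rightarrow> fst \<alpha> | Sp2 \<Rightarrow> fst (snd \<alpha>))
     + (m i *\<^sub>R fst (snd (snd \<alpha>))) \<bullet> v + m i * snd (snd (snd \<alpha>)) * (norm v)\<^sup>2"
  by (cases \<alpha>; cases i) (simp_all add: algebra_simps)

lemma integrable_lebesgue_on_iff_set_integrable:
  fixes f :: "'a::euclidean_space \<Rightarrow> 'b::{banach, second_countable_topology}"
  assumes "V \<in> sets lebesgue"
  shows "set_integrable lebesgue V f \<longleftrightarrow> integrable (lebesgue_on V) f"
  using assms by (simp add: set_integrable_def integrable_restrict_space)

lemma set_lebesgue_integral_eq_lebesgue_on: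
  fixes f :: "'a::euclidean_space \<Rightarrow> 'b::{banach, second_countable_topology}"
  assumes "V \<in> sets lebesgue"
  shows "set_lebesgue_integral lebesgue V f = integral\<^sup>L (lebesgue_on V) f"
  using assms by (simp add: set_lebesgue_integral_def integral_restrict_space)

text \<open>Carries finite moments and entropies of f over to the weighted integrands; the bound
  used for the weights is \<open>1 / dt\<close>.\<close>

lemma integrable_bounded_mult:
  fixes w g :: "'a \<Rightarrow> real"
  assumes "integrable M g" "w \<in> borel_measurable M"
    and "\<And>x. x \<in> space M \<Longrightarrow> 0 \<le> w x" "\<And>x. x \<in> space M \<Longrightarrow> w x \<le> B"
  shows "integrable M (\<lambda>x. w x * g x)"
proof (rule Bochner_Integration.integrable_bound)
  show "integrable M (\<lambda>x. B * g x)" using assms by simp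
  show "(\<lambda>x. w x * g x) \<in> borel_measurable M" using assms by measurable
  have "\<bar>w x\<bar> \<le> \<bar>B\<bar>" if "x \<in> space M" for x
    using assms(3,4)[OF that] by linarith
  then show "AE x in M. norm (w x * g x) \<le> norm (B * g x)"
    by (intro AE_I2) (simp add: abs_mult mult_right_mono)
qed

lemma finite_moments_integrable_quadratic:
  assumes V: "V \<in> sets lebesgue" and f: "finite_moments V f"
  shows "integrable (lebesgue_on V) (\<lambda>v. f v * (a + b \<bullet> v + c * (norm v)\<^sup>2))"
proof -
  have "integrable (lebesgue_on V) (\<lambda>v. a * f v + b \<bullet> (f v *\<^sub>R v) + c * (f v * (norm v)\<^sup>2))"
    using f unfolding finite_moments_def integrable_lebesgue_on_iff_set_integrable[OF V]
    by (intro Bochner_Integration.integrable_add integrable_mult_right integrable_inner_right) auto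
  moreover have "a * f v + b \<bullet> (f v *\<^sub>R v) + c * (f v * (norm v)\<^sup>2)
      = f v * (a + b \<bullet> v + c * (norm v)\<^sup>2)" for v
    by (simp add: algebra_simps)
  ultimately show ?thesis by simp
qed

section \<open>Entropy decay in the relaxation step\<close>

lemma weighted_freq_nonneg:
  assumes "dt > 0" "\<And>i j. \<nu> i j k v \<ge> 0"
  shows "weighted_freq dt \<nu> i j k v \<ge> 0"
  using assms by (simp add: weighted_freq_def relax_coeff_def)

text \<open>The coefficient is the reciprocal of exactly the sum that the three terms form, which
  makes the implicit step a convex combination of the old value and the two targets.\<close>

lemma relax_coeff_add_weighted_freq:
  assumes "dt > 0" "\<And>i j. \<nu> i j k v \<ge> 0"
  shows "relax_coeff dt \<nu> i k v + dt * weighted_freq dt \<nu> i i k v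
    + dt * weighted_freq dt \<nu> i (other i) k v = 1"
proof -
  let ?s = "1 + dt * (\<nu> i i k v + \<nu> i (other i) k v)"
  have "?s > 0"
    using assms by (intro add_pos_nonneg mult_nonneg_nonneg add_nonneg_nonneg) auto
  then have "relax_coeff dt \<nu> i k v * ?s = 1" by (simp add: relax_coeff_def)
  then show ?thesis by (simp add: weighted_freq_def algebra_simps)
qed

text \<open>Each term of the partition of 1 is nonnegative, hence at most 1. The bound is uniform in
  the frequencies, which may themselves be unbounded.\<close>

lemma weighted_freq_le:
  assumes "dt > 0" "\<And>i j. \<nu> i j k v \<ge> 0" "j = i \<or> j = other i"
  shows "weighted_freq dt \<nu> i j k v \<le> 1 / dt"
proof -
  have "relax_coeff dt \<nu> i k v \<ge> 0" using assms by (simp add: relax_coeff_def)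
  moreover have "dt * weighted_freq dt \<nu> i i k v \<ge> 0" "dt * weighted_freq dt \<nu> i (other i) k v \<ge> 0"
    using assms weighted_freq_nonneg[of dt \<nu> k v] by simp_all
  ultimately have "dt * weighted_freq dt \<nu> i j k v \<le> 1"
    using relax_coeff_add_weighted_freq[of dt \<nu> k v i, OF assms(1,2)] assms(3) by auto
  then show ?thesis using assms by (simp add: field_simps)
qed

lemma weighted_freq_measurable:
  assumes "\<And>i j. \<nu> i j k \<in> borel_measurable M"
  shows "weighted_freq dt \<nu> i j k \<in> borel_measurable M"
  unfolding weighted_freq_def[abs_def] relax_coeff_def using assms by measurable

lemma relaxation_step_alt:
  "relaxation_step dt m \<nu> lam_self lam_mix f i k v = relax_coeff dt \<nu> i k v * f i k v
     + dt * weighted_freq dt \<nu> i i k v * target_self m lam_self i k v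
     + dt * weighted_freq dt \<nu> i (other i) k v * target_mix m lam_mix i k v"
  by (simp add: relaxation_step_def weighted_freq_def algebra_simps)

lemma relaxation_step_nonneg:
  assumes "dt > 0" "\<And>i j. \<nu> i j k v \<ge> 0" "f i k v \<ge> 0"
  shows "relaxation_step dt m \<nu> lam_self lam_mix f i k v \<ge> 0"
  using assms weighted_freq_nonneg[of dt \<nu> k v] unfolding relaxation_step_alt
  by (simp add: relax_coeff_def target_self_def target_mix_def)

text \<open>Jensen's inequality, with the weight of the old value written as 1 minus the other two.
  This isolates the differences h(A) - h(f), whose weighted integrals the minimization
  controls.\<close>

lemma entropy_relaxation_step_le:
  assumes "dt > 0" "\<And>i j. \<nu> i j k v \<ge> 0" "f i k v \<ge> 0"
  shows "entropy_density (relaxation_step dt m \<nu> lam_self lam_mix f i k v)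
    \<le> entropy_density (f i k v)
      + dt * (weighted_freq dt \<nu> i i k v
          * (entropy_density (target_self m lam_self i k v) - entropy_density (f i k v)))
      + dt * (weighted_freq dt \<nu> i (other i) k v
          * (entropy_density (target_mix m lam_mix i k v) - entropy_density (f i k v)))"
proof -
  let ?c = "relax_coeff dt \<nu> i k v" and ?p = "dt * weighted_freq dt \<nu> i i k v"
    and ?q = "dt * weighted_freq dt \<nu> i (other i) k v"
  have sum: "?c + ?p + ?q = 1" using assms by (intro relax_coeff_add_weighted_freq) auto
  have c: "?c \<ge> 0" using assms by (simp add: relax_coeff_def)
  have pq: "?p \<ge> 0" "?q \<ge> 0" using assms weighted_freq_nonneg[of dt \<nu> k v] by simp_all
  have "entropy_density (relaxation_step dt m \<nu> lam_self lam_mix f i k v)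
      \<le> ?c * entropy_density (f i k v) + ?p * entropy_density (target_self m lam_self i k v)
        + ?q * entropy_density (target_mix m lam_mix i k v)"
    unfolding relaxation_step_alt using c pq sum assms(3)
    by (intro entropy_density_Jensen3) (auto simp: target_self_def target_mix_def)
  moreover have "?c = 1 - ?p - ?q" using sum by linarith
  ultimately show ?thesis by (simp add: algebra_simps)
qed

lemma self_relaxation_entropy_le:
  assumes V: "V \<in> sets lebesgue"
    and w: "w \<in> borel_measurable (lebesgue_on V)" "\<And>v. v \<in> V \<Longrightarrow> 0 \<le> w v" "\<And>v. v \<in> V \<Longrightarrow> w v \<le> B"
    and f: "\<And>v. v \<in> V \<Longrightarrow> 0 \<le> f v" "finite_moments V f"
      "set_integrable lebesgue V (\<lambda>v. entropy_density (f v))"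
    and finite: "self_potential_finite V \<mu> w f"
    and min: "is_unique_minimizer (self_potential V \<mu> w f) \<Lambda>_self lam"
    and target: "set_integrable lebesgue V (\<lambda>v. w v * entropy_density (exp (lam \<bullet> invariants \<mu> v)))"
  shows "(\<integral>v. w v * (entropy_density (exp (lam \<bullet> invariants \<mu> v)) - entropy_density (f v)) \<partial>lebesgue_on V) \<le> 0"
proof -
  note on = integrable_lebesgue_on_iff_set_integrable[OF V]
  have lam: "lam \<in> \<Lambda>_self" using min by (simp add: is_unique_minimizer_def is_arg_min_def)
  \<comment> \<open>The only constraint is a negative last component, which survives positive
    scaling but fails at \<open>t = 0\<close>.\<close>
  have ray: "t *\<^sub>R lam \<in> \<Lambda>_self" if "t > 0" for t
    using lam that by (auto simp: \<Lambda>_self_def mult_less_0_iff)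
  have potential: "self_potential V \<mu> w f (t *\<^sub>R lam)
      = (\<integral>v. w v * exp (t * (lam \<bullet> invariants \<mu> v)) \<partial>lebesgue_on V)
        - t * (\<integral>v. w v * f v * (lam \<bullet> invariants \<mu> v) \<partial>lebesgue_on V)" for t
    using finite integral_inner_right[of lam "lebesgue_on V" "\<lambda>v. (w v * f v) *\<^sub>R invariants \<mu> v"]
    by (simp add: self_potential_def self_potential_finite_def on
        set_lebesgue_integral_eq_lebesgue_on[OF V])
  have "(\<integral>v. (\<Sum>i\<in>{()}. w v * (entropy_density (exp (lam \<bullet> invariants \<mu> v)) - entropy_density (f v))) \<partial>lebesgue_on V) \<le> 0"
  proof (rule minimizer_entropy_le)
    show "integrable (lebesgue_on V) (\<lambda>v. w v * exp (t * (lam \<bullet> invariants \<mu> v)))" if "0 < t" for t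
      using finite ray[OF that] by (auto simp: self_potential_finite_def on dest!: bspec[of _ _ "t *\<^sub>R lam"])
    have "integrable (lebesgue_on V) (\<lambda>v. w v * (f v * (lam \<bullet> invariants \<mu> v)))"
      unfolding inner_invariants
      by (rule integrable_bounded_mult[where B = B, OF finite_moments_integrable_quadratic[OF V f(2)]])
        (use w in auto)
    then show "integrable (lebesgue_on V) (\<lambda>v. w v * f v * (lam \<bullet> invariants \<mu> v))"
      by (simp add: mult.assoc)
    show "integrable (lebesgue_on V) (\<lambda>v. w v * entropy_density (f v))"
      using f w by (intro integrable_bounded_mult) (auto simp: on)
    show "(\<integral>v. (\<Sum>i\<in>{()}. w v * exp (lam \<bullet> invariants \<mu> v)) \<partial>lebesgue_on V)
        - (\<integral>v. (\<Sum>i\<in>{()}. w v * f v * (lam \<bullet> invariants \<mu> v)) \<partial>lebesgue_on V)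
      \<le> (\<integral>v. (\<Sum>i\<in>{()}. w v * exp (t * (lam \<bullet> invariants \<mu> v))) \<partial>lebesgue_on V)
        - t * (\<integral>v. (\<Sum>i\<in>{()}. w v * f v * (lam \<bullet> invariants \<mu> v)) \<partial>lebesgue_on V)" if "0 < t" for t
      using is_unique_minimizer_le[OF min ray[OF that]] potential[of 1] potential[of t] by simp
  qed (use w f target in \<open>auto simp: on\<close>)
  then show ?thesis by simp
qed

text \<open>Both species share one multiplier, so optimality controls the sum over the species and
  not each term separately.\<close>

lemma mix_relaxation_entropy_le:
  fixes w f :: "species \<Rightarrow> velocity \<Rightarrow> real"
  assumes V: "V \<in> sets lebesgue"
    and w: "\<And>i. w i \<in> borel_measurable (lebesgue_on V)" "\<And>i v. v \<in> V \<Longrightarrow> 0 \<le> w i v"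
      "\<And>i v. v \<in> V \<Longrightarrow> w i v \<le> B"
    and f: "\<And>i v. v \<in> V \<Longrightarrow> 0 \<le> f i v" "\<And>i. finite_moments V (f i)"
      "\<And>i. set_integrable lebesgue V (\<lambda>v. entropy_density (f i v))"
    and finite: "mix_potential_finite V m (w Sp1) (w Sp2) (f Sp1) (f Sp2)"
    and min: "is_unique_minimizer (mix_potential V m (w Sp1) (w Sp2) (f Sp1) (f Sp2)) \<Lambda>_mix lam"
    and target: "\<And>i. set_integrable lebesgue V (\<lambda>v. w i v * entropy_density (exp (lam \<bullet> mix_invariants m i v)))"
  shows "(\<integral>v. (\<Sum>i\<in>{Sp1, Sp2}. w i v
      * (entropy_density (exp (lam \<bullet> mix_invariants m i v)) - entropy_density (f i v))) \<partial>lebesgue_on V) \<le> 0"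
proof -
  note on = integrable_lebesgue_on_iff_set_integrable[OF V]
  have lam: "lam \<in> \<Lambda>_mix" using min by (simp add: is_unique_minimizer_def is_arg_min_def)
  have ray: "t *\<^sub>R lam \<in> \<Lambda>_mix" if "t > 0" for t
    using lam that by (auto simp: \<Lambda>_mix_def mult_less_0_iff)
  have potential: "mix_potential V m (w Sp1) (w Sp2) (f Sp1) (f Sp2) (t *\<^sub>R lam)
      = (\<integral>v. (\<Sum>i\<in>{Sp1, Sp2}. w i v * exp (t * (lam \<bullet> mix_invariants m i v))) \<partial>lebesgue_on V)
        - t * (\<integral>v. (\<Sum>i\<in>{Sp1, Sp2}. w i v * f i v * (lam \<bullet> mix_invariants m i v)) \<partial>lebesgue_on V)" for t
    using finite integral_inner_right[of lam "lebesgue_on V"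
        "\<lambda>v. (w Sp1 v * f Sp1 v) *\<^sub>R mix_invariants m Sp1 v + (w Sp2 v * f Sp2 v) *\<^sub>R mix_invariants m Sp2 v"]
    by (simp add: mix_potential_def mix_potential_finite_def on inner_add_right
        set_lebesgue_integral_eq_lebesgue_on[OF V] del: mix_invariants.simps)
  show ?thesis
  proof (rule minimizer_entropy_le)
    fix i :: species and t :: real assume t: "0 < t"
    \<comment> \<open>Finiteness is assumed for the sum of the two exponential terms. Each term is
      nonnegative and thus dominated by the sum; its measurability comes from that of the weight and
      continuity of the exponential.\<close>
    have measurable: "(\<lambda>v. w i v * exp (t * (lam \<bullet> mix_invariants m i v))) \<in> borel_measurable (lebesgue_on V)"
      unfolding inner_mix_invariants
      by (intro borel_measurable_times w continuous_imp_measurable_on_sets_lebesgue V continuous_intros)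
    have "integrable (lebesgue_on V) (\<lambda>v. w Sp1 v * exp (t * (lam \<bullet> mix_invariants m Sp1 v))
        + w Sp2 v * exp (t * (lam \<bullet> mix_invariants m Sp2 v)))"
      using finite ray[OF t]
      by (auto simp: mix_potential_finite_def on simp del: mix_invariants.simps dest!: bspec[of _ _ "t *\<^sub>R lam"])
    then show "integrable (lebesgue_on V) (\<lambda>v. w i v * exp (t * (lam \<bullet> mix_invariants m i v)))"
    proof (rule Bochner_Integration.integrable_bound)
      show "AE v in lebesgue_on V. norm (w i v * exp (t * (lam \<bullet> mix_invariants m i v)))
          \<le> norm (w Sp1 v * exp (t * (lam \<bullet> mix_invariants m Sp1 v))
            + w Sp2 v * exp (t * (lam \<bullet> mix_invariants m Sp2 v)))"
        using w(2) by (intro AE_I2, cases i) (simp_all del: mix_invariants.simps)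
    qed (use measurable in simp)
  next
    fix i :: species
    have "integrable (lebesgue_on V) (\<lambda>v. w i v * (f i v * (lam \<bullet> mix_invariants m i v)))"
      unfolding inner_mix_invariants
      by (rule integrable_bounded_mult[where B = B, OF finite_moments_integrable_quadratic[OF V f(2)]])
        (use w in auto)
    then show "integrable (lebesgue_on V) (\<lambda>v. w i v * f i v * (lam \<bullet> mix_invariants m i v))"
      by (simp add: mult.assoc)
    show "integrable (lebesgue_on V) (\<lambda>v. w i v * entropy_density (f i v))"
      using f w by (intro integrable_bounded_mult) (auto simp: on)
  next
    fix t :: real assume t: "0 < t"
    show "(\<integral>v. (\<Sum>i\<in>{Sp1, Sp2}. w i v * exp (lam \<bullet> mix_invariants m i v)) \<partial>lebesgue_on V)
        - (\<integral>v. (\<Sum>i\<in>{Sp1, Sp2}. w i v * f i v * (lam \<bullet> mix_invariants m i v)) \<partial>lebesgue_on V)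
      \<le> (\<integral>v. (\<Sum>i\<in>{Sp1, Sp2}. w i v * exp (t * (lam \<bullet> mix_invariants m i v))) \<partial>lebesgue_on V)
        - t * (\<integral>v. (\<Sum>i\<in>{Sp1, Sp2}. w i v * f i v * (lam \<bullet> mix_invariants m i v)) \<partial>lebesgue_on V)"
      using is_unique_minimizer_le[OF min ray[OF t]] potential[of 1] potential[of t] by simp
  qed (use w f target in \<open>auto simp: on simp del: mix_invariants.simps\<close>)
qed

section \<open>Entropy decay in the transport step\<close>

lemma sum_int_shift_up:
  fixes g :: "int \<Rightarrow> real"
  shows "(\<Sum>k = 0..int K. g (k + 1)) = (\<Sum>k = 0..int K. g k) - g 0 + g (int K + 1)"
proof (induction K)
  case (Suc K)
  have "{0..int (Suc K)} = insert (int K + 1) {0..int K}" by auto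
  then show ?case using Suc by (simp add: algebra_simps)
qed simp

lemma sum_int_shift_down:
  fixes g :: "int \<Rightarrow> real"
  shows "(\<Sum>k = 0..int K. g (k - 1)) = (\<Sum>k = 0..int K. g k) - g (int K) + g (-1)"
  using sum_int_shift_up[of "\<lambda>k. g (k - 1)" K] by simp

text \<open>The coefficients are the positive and negative parts of the first velocity component, so
  the flux takes its value from the upwind cell.\<close>

lemma flux_upwind:
  "flux g k v = (\<bar>v $ 1\<bar> + v $ 1) / 2 * g k v - (\<bar>v $ 1\<bar> - v $ 1) / 2 * g (k + 1) v"
  by (simp add: flux_def field_simps)

text \<open>The new value has weights \<open>1 - p - q\<close>, \<open>p\<close>, \<open>q\<close>
  on a cell and its left and right neighbours, with \<open>p + q\<close> equal to dt |v^1| / dx, at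
  most 1 by the CFL condition. After Jensen, summation over the cells leaves only boundary
  terms.\<close>

lemma sum_entropy_transport_step_le:
  assumes pos: "dt > 0" "dx > 0" and cfl: "dt * \<bar>v $ 1\<bar> \<le> dx"
    and g: "\<And>k. k \<in> {-1..int K + 1} \<Longrightarrow> g k v \<ge> 0"
    and v: "v \<in> V" and boundary: "periodic_bc V K g \<or> zero_bc V K g"
  shows "(\<Sum>k = 0..int K. entropy_density (transport_step dt dx g k v))
    \<le> (\<Sum>k = 0..int K. entropy_density (g k v))"
proof -
  define a where "a = (\<bar>v $ 1\<bar> + v $ 1) / 2"
  define b where "b = (\<bar>v $ 1\<bar> - v $ 1) / 2"
  define p where "p = dt / dx * a"
  define q where "q = dt / dx * b"
  let ?h = "\<lambda>k. entropy_density (g k v)"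
  have pq: "p \<ge> 0" "q \<ge> 0" using pos by (auto simp: p_def q_def a_def b_def)
  have "p + q = dt / dx * \<bar>v $ 1\<bar>"
    unfolding p_def q_def distrib_left[symmetric] by (simp add: a_def b_def field_simps)
  moreover have "dt / dx * \<bar>v $ 1\<bar> \<le> 1" using cfl pos by (simp add: field_simps)
  ultimately have pq1: "p + q \<le> 1" by simp
  have step: "transport_step dt dx g k v = (1 - p - q) * g k v + p * g (k - 1) v + q * g (k + 1) v" for k
    unfolding transport_step_def flux_upwind a_def[symmetric] b_def[symmetric] p_def q_def
    by (simp add: algebra_simps)
  have boundary_terms: "p * (?h (-1) - ?h (int K)) + q * (?h (int K + 1) - ?h 0) = 0"
    using boundary
  proof
    assume "periodic_bc V K g"
    then show ?thesis using v by (simp add: periodic_bc_def)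
  next
    assume "zero_bc V K g"
    then have zero: "flux g (int K) v = 0" "flux g (-1) v = 0" using v by (auto simp: zero_bc_def)
    \<comment> \<open>For positive velocity \<open>q = 0\<close>, and the zero fluxes force the
      values in cells \<open>K\<close> and -1 to vanish. For negative velocity \<open>p = 0\<close>,
      and they force those in cells \<open>K + 1\<close> and 0 to vanish. At zero velocity
      \<open>p = q = 0\<close>.\<close>
    consider "v $ 1 > 0" | "v $ 1 = 0" | "v $ 1 < 0" by linarith
    then show ?thesis using zero by cases (auto simp: flux_upwind p_def q_def a_def b_def)
  qed
  have "(\<Sum>k = 0..int K. entropy_density (transport_step dt dx g k v))
      \<le> (\<Sum>k = 0..int K. (1 - p - q) * ?h k + p * ?h (k - 1) + q * ?h (k + 1))"
    unfolding step using pq pq1 g by (intro sum_mono entropy_density_Jensen3) auto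
  also have "\<dots> = (\<Sum>k = 0..int K. ?h k) + p * (?h (-1) - ?h (int K)) + q * (?h (int K + 1) - ?h 0)"
    unfolding sum.distrib sum_distrib_left[symmetric] sum_int_shift_up[of ?h] sum_int_shift_down[of ?h]
    by (simp add: algebra_simps)
  also have "\<dots> = (\<Sum>k = 0..int K. ?h k)"
    using boundary_terms by linarith
  finally show ?thesis .
qed

section \<open>Combination of the two steps\<close>

theorem corollary5p2:
  fixes V :: "velocity set" and K :: nat and dt dx :: real
    and m :: "species \<Rightarrow> real"
    and \<nu> :: "species \<Rightarrow> species \<Rightarrow> int \<Rightarrow> velocity \<Rightarrow> real"
    and f f' f_new :: "species \<Rightarrow> int \<Rightarrow> velocity \<Rightarrow> real"
    and lam_self :: "species \<Rightarrow> int \<Rightarrow> real \<times> velocity \<times> real"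
    and lam_mix :: "int \<Rightarrow> real \<times> real \<times> velocity \<times> real"
  assumes V: "V \<in> sets lebesgue" "bdd_above ((\<lambda>v. \<bar>v $ 1\<bar>) ` V)"
    and mass_pos: "\<And>i. m i > 0"
    and steps_pos: "dt > 0" "dx > 0"
    and f_nonneg: "\<And>i k v. k \<in> {0..int K} \<Longrightarrow> v \<in> V \<Longrightarrow> f i k v \<ge> 0"
    and f_moments: "\<And>i k. k \<in> {0..int K} \<Longrightarrow> finite_moments V (f i k)"
    and f_entropy: "\<And>i k. k \<in> {0..int K} \<Longrightarrow>
          set_integrable lebesgue V (\<lambda>v. entropy_density (f i k v))"
    and nu_nonneg: "\<And>i j k v. k \<in> {0..int K} \<Longrightarrow> v \<in> V \<Longrightarrow> \<nu> i j k v \<ge> 0"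
    and nu_measurable: "\<And>i j k. k \<in> {0..int K} \<Longrightarrow> \<nu> i j k \<in> borel_measurable (lebesgue_on V)"
    \<comment> \<open>relaxation step\<close>
    and self_finite: "\<And>i k. k \<in> {0..int K} \<Longrightarrow>
          self_potential_finite V (m i) (weighted_freq dt \<nu> i i k) (f i k)"
    and self_min: "\<And>i k. k \<in> {0..int K} \<Longrightarrow>
          is_unique_minimizer
            (self_potential V (m i) (weighted_freq dt \<nu> i i k) (f i k)) \<Lambda>_self (lam_self i k)"
    and mix_finite: "\<And>k. k \<in> {0..int K} \<Longrightarrow>
          mix_potential_finite V m (weighted_freq dt \<nu> Sp1 Sp2 k) (weighted_freq dt \<nu> Sp2 Sp1 k)
            (f Sp1 k) (f Sp2 k)"
    and mix_min: "\<And>k. k \<in> {0..int K} \<Longrightarrow>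
          is_unique_minimizer
            (mix_potential V m (weighted_freq dt \<nu> Sp1 Sp2 k) (weighted_freq dt \<nu> Sp2 Sp1 k)
              (f Sp1 k) (f Sp2 k)) \<Lambda>_mix (lam_mix k)"
    and relaxation: "\<And>i k v. k \<in> {0..int K} \<Longrightarrow> v \<in> V \<Longrightarrow>
          f' i k v = relaxation_step dt m \<nu> lam_self lam_mix f i k v"
    \<comment> \<open>transport step\<close>
    and ghost_nonneg: "\<And>i k v. k \<in> {-1, int K + 1} \<Longrightarrow> v \<in> V \<Longrightarrow> f' i k v \<ge> 0"
    and boundary: "(\<forall>i. periodic_bc V K (f' i)) \<or> (\<forall>i. zero_bc V K (f' i))"
    and transport: "\<And>i k v. k \<in> {0..int K} \<Longrightarrow> v \<in> V \<Longrightarrow>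
          f_new i k v = transport_step dt dx (f' i) k v"
    \<comment> \<open>finiteness of the remaining entropy integrals\<close>
    and target_self_entropy: "\<And>i k. k \<in> {0..int K} \<Longrightarrow>
          set_integrable lebesgue V
            (\<lambda>v. weighted_freq dt \<nu> i i k v * entropy_density (target_self m lam_self i k v))"
    and target_mix_entropy: "\<And>i k. k \<in> {0..int K} \<Longrightarrow>
          set_integrable lebesgue V
            (\<lambda>v. weighted_freq dt \<nu> i (other i) k v * entropy_density (target_mix m lam_mix i k v))"
    and f'_entropy: "\<And>i k. k \<in> {0..int K} \<Longrightarrow>
          set_integrable lebesgue V (\<lambda>v. entropy_density (f' i k v))"
    and f_new_entropy: "\<And>i k. k \<in> {0..int K} \<Longrightarrow>
          set_integrable lebesgue V (\<lambda>v. entropy_density (f_new i k v))"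
    and cfl: "dt \<le> dx / (SUP v\<in>V. \<bar>v $ 1\<bar>)"
  shows "total_entropy V K dx f_new \<le> total_entropy V K dx f"
proof -
  let ?M = "lebesgue_on V" and ?h = entropy_density
  let ?w = "weighted_freq dt \<nu>"
  let ?A = "target_self m lam_self" and ?B = "target_mix m lam_mix"
  note on = integrable_lebesgue_on_iff_set_integrable[OF V(1)]
  have total: "total_entropy V K dx g
      = (\<Sum>k = 0..int K. \<integral>v. (\<Sum>i\<in>{Sp1, Sp2}. ?h (g i k v)) \<partial>?M) * dx" for g
    by (simp add: total_entropy_def set_lebesgue_integral_eq_lebesgue_on[OF V(1)] sum_distrib_right)

  \<comment> \<open>Relaxation decreases the integral in each cell, transport the sum over the cells
    at each velocity; exchanging sum and integral links the two estimates.\<close>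
  have swap: "(\<integral>v. (\<Sum>i\<in>{Sp1, Sp2}. \<Sum>k = 0..int K. ?h (g i k v)) \<partial>?M)
      = (\<Sum>k = 0..int K. \<integral>v. (\<Sum>i\<in>{Sp1, Sp2}. ?h (g i k v)) \<partial>?M)"
    if "\<And>i k. k \<in> {0..int K} \<Longrightarrow> set_integrable lebesgue V (\<lambda>v. ?h (g i k v))" for g
    unfolding sum.swap[of _ "{0..int K}"] using that
    by (intro Bochner_Integration.integral_sum Bochner_Integration.integrable_sum) (simp only: on)

  have relaxed: "(\<integral>v. (\<Sum>i\<in>{Sp1, Sp2}. ?h (f' i k v)) \<partial>?M) \<le> (\<integral>v. (\<Sum>i\<in>{Sp1, Sp2}. ?h (f i k v)) \<partial>?M)"
    if k: "k \<in> {0..int K}" for k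
  proof -
    have w: "?w i j k \<in> borel_measurable ?M" for i j
      using nu_measurable[OF k] by (rule weighted_freq_measurable)
    have w0: "0 \<le> ?w i j k v" if "v \<in> V" for i j v
      using weighted_freq_nonneg[of dt \<nu> k v] steps_pos nu_nonneg[OF k that] by simp
    have w1: "?w i j k v \<le> 1 / dt" if "v \<in> V" "j = i \<or> j = other i" for i j v
      using weighted_freq_le[of dt \<nu> k v j i] steps_pos nu_nonneg[OF k that(1)] that(2) by simp
    \<comment> \<open>\<open>D\<close> is the self-collision contribution, with nonpositive integral
      for each species; \<open>E\<close> is the mixed one, for which only the integral of the
      species sum has a sign.\<close>
    define D where "D i v = ?w i i k v * (?h (?A i k v) - ?h (f i k v))" for i v
    define E where "E i v = ?w i (other i) k v * (?h (?B i k v) - ?h (f i k v))" for i v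
    have int_wf: "integrable ?M (\<lambda>v. ?w i j k v * ?h (f i k v))" if "j = i \<or> j = other i" for i j
      using f_entropy[OF k] w w0 w1 that
      by (intro integrable_bounded_mult[where B = "1 / dt"]) (auto simp: on)
    have int_D: "integrable ?M (D i)" and int_E: "integrable ?M (E i)" for i
      using target_self_entropy[OF k] target_mix_entropy[OF k] int_wf
      by (auto simp: D_def[abs_def] E_def[abs_def] right_diff_distrib on)
    have D: "(\<integral>v. D i v \<partial>?M) \<le> 0" for i
      unfolding D_def target_self_def
      using w w0 w1 f_nonneg[OF k] f_moments[OF k] f_entropy[OF k] self_finite[OF k] self_min[OF k]
        target_self_entropy[OF k, unfolded target_self_def]
      by (intro self_relaxation_entropy_le[OF V(1), where B = "1 / dt"]) auto
    have E: "(\<integral>v. (\<Sum>i\<in>{Sp1, Sp2}. E i v) \<partial>?M) \<le> 0"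
      unfolding E_def target_mix_def
      using w w0 w1 f_nonneg[OF k] f_moments[OF k] f_entropy[OF k] mix_finite[OF k] mix_min[OF k]
        target_mix_entropy[OF k, unfolded target_mix_def]
      by (intro mix_relaxation_entropy_le[OF V(1), where w = "\<lambda>i. ?w i (other i) k"
            and f = "\<lambda>i. f i k" and B = "1 / dt"]) auto
    have "(\<integral>v. (\<Sum>i\<in>{Sp1, Sp2}. ?h (f' i k v)) \<partial>?M)
        \<le> (\<integral>v. (\<Sum>i\<in>{Sp1, Sp2}. ?h (f i k v) + dt * D i v + dt * E i v) \<partial>?M)"
    proof (rule integral_mono)
      fix v assume "v \<in> space ?M"
      then have v: "v \<in> V" by simp
      show "(\<Sum>i\<in>{Sp1, Sp2}. ?h (f' i k v)) \<le> (\<Sum>i\<in>{Sp1, Sp2}. ?h (f i k v) + dt * D i v + dt * E i v)"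
        unfolding D_def E_def relaxation[OF k v]
        using steps_pos nu_nonneg[OF k v] f_nonneg[OF k v]
        by (intro sum_mono entropy_relaxation_step_le) auto
    qed (use f'_entropy[OF k] f_entropy[OF k] int_D int_E in \<open>auto simp: on\<close>)
    also have "\<dots> = (\<integral>v. (\<Sum>i\<in>{Sp1, Sp2}. ?h (f i k v)) \<partial>?M)
        + dt * ((\<integral>v. D Sp1 v \<partial>?M) + (\<integral>v. D Sp2 v \<partial>?M) + (\<integral>v. (\<Sum>i\<in>{Sp1, Sp2}. E i v) \<partial>?M))"
      using f_entropy[OF k] int_D int_E by (simp add: on algebra_simps)
    also have "\<dots> \<le> (\<integral>v. (\<Sum>i\<in>{Sp1, Sp2}. ?h (f i k v)) \<partial>?M)"
      using steps_pos D[of Sp1] D[of Sp2] E by (simp add: mult_le_0_iff)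
    finally show ?thesis .
  qed

  have transported: "(\<Sum>k = 0..int K. ?h (f_new i k v)) \<le> (\<Sum>k = 0..int K. ?h (f' i k v))"
    if v: "v \<in> V" for i v
  proof -
    \<comment> \<open>Since \<open>dx / 0 = 0\<close>, the hypothesis \<open>dt > 0\<close> rules out a vanishing supremum.\<close>
    have "0 < dx / (SUP v\<in>V. \<bar>v $ 1\<bar>)" using cfl steps_pos by linarith
    then have "(SUP v\<in>V. \<bar>v $ 1\<bar>) > 0" using steps_pos by (simp add: zero_less_divide_iff)
    then have "dt * (SUP v\<in>V. \<bar>v $ 1\<bar>) \<le> dx" using cfl by (simp add: field_simps)
    moreover have "dt * \<bar>v $ 1\<bar> \<le> dt * (SUP v\<in>V. \<bar>v $ 1\<bar>)"
      using steps_pos cSUP_upper[OF v V(2)] by simp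
    ultimately have cfl_v: "dt * \<bar>v $ 1\<bar> \<le> dx" by linarith
    \<comment> \<open>Jensen in cells 0 and \<open>K\<close> also involves the ghost values; their
      sign is a hypothesis, while in the physical cells it is inherited through the relaxation
      step.\<close>
    have nonneg: "f' i k v \<ge> 0" if "k \<in> {-1..int K + 1}" for k
    proof (cases "k \<in> {0..int K}")
      case True
      then show ?thesis
        using relaxation_step_nonneg[of dt \<nu> k v f i m lam_self lam_mix] steps_pos
          nu_nonneg[OF True v] f_nonneg[OF True v] relaxation[OF True v] by simp
    next
      case False
      then have "k \<in> {-1, int K + 1}" using that by auto
      then show ?thesis using ghost_nonneg v by blast
    qed
    have "(\<Sum>k = 0..int K. ?h (f_new i k v)) = (\<Sum>k = 0..int K. ?h (transport_step dt dx (f' i) k v))"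
      using transport[OF _ v] by simp
    also have "\<dots> \<le> (\<Sum>k = 0..int K. ?h (f' i k v))"
      using steps_pos cfl_v nonneg v boundary by (intro sum_entropy_transport_step_le) auto
    finally show ?thesis .
  qed

  have "(\<Sum>k = 0..int K. \<integral>v. (\<Sum>i\<in>{Sp1, Sp2}. ?h (f_new i k v)) \<partial>?M)
      = (\<integral>v. (\<Sum>i\<in>{Sp1, Sp2}. \<Sum>k = 0..int K. ?h (f_new i k v)) \<partial>?M)"
    using swap[of f_new] f_new_entropy by simp
  also have "\<dots> \<le> (\<integral>v. (\<Sum>i\<in>{Sp1, Sp2}. \<Sum>k = 0..int K. ?h (f' i k v)) \<partial>?M)"
  proof (rule integral_mono)
    show "(\<Sum>i\<in>{Sp1, Sp2}. \<Sum>k = 0..int K. ?h (f_new i k v))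
        \<le> (\<Sum>i\<in>{Sp1, Sp2}. \<Sum>k = 0..int K. ?h (f' i k v))" if "v \<in> space ?M" for v
      using that by (intro sum_mono[of "{Sp1, Sp2}"] transported) simp
  qed (use f_new_entropy f'_entropy in \<open>auto simp: on intro!: Bochner_Integration.integrable_sum\<close>)
  also have "\<dots> = (\<Sum>k = 0..int K. \<integral>v. (\<Sum>i\<in>{Sp1, Sp2}. ?h (f' i k v)) \<partial>?M)"
    using f'_entropy by (rule swap)
  also have "\<dots> \<le> (\<Sum>k = 0..int K. \<integral>v. (\<Sum>i\<in>{Sp1, Sp2}. ?h (f i k v)) \<partial>?M)"
    by (intro sum_mono relaxed)
  finally show ?thesis
    unfolding total using steps_pos by (intro mult_right_mono) auto
qed

end
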